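(* Let $\mathbb{F}$ be a field of characteristic zero and let $A,B\in M_n(\mathbb{F})$ be balanced matrices (this includes nilpotent matrices). Then $\mathcal{CL}(A)=\mathcal{CL}(B)$ if and only if $A$ and $B$ are odd polynomial equivalent.
   Context: The clifforder of $A\in M_n(\mathbb{F})$ is $\mathcal{CL}(A)=\{X\in M_n(\mathbb{F})\mid AX=-XA\}$. A monic polynomial $f(x)\in\mathbb{F}[x]$ is called balanced if $f(-x)=(-1)^{\deg f}f(x)$. A matrix $A\in M_n(\mathbb{F})$ is called balanced if all of its invariant factors are balanced polynomials. Matrices $A,B\in M_n(\mathbb{F})$ are odd polynomial equivalent if there exist polynomials $j(x)=\sum_{i\ge 0}a_{2i+1}x^{2i+1}$ and $k(x)=\sum_{i\ge 0}b_{2i+1}x^{2i+1}$ in $\mathbb{F}[x]$ (only odd-degree terms) such that $A=k(B)$ and $B=j(A)$. *)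

theory Defs
  imports "Jordan_Normal_Form.Matrix" "HOL-Computational_Algebra.Polynomial"
begin

definition clifforder :: "nat \<Rightarrow> 'a :: comm_ring_1 mat \<Rightarrow> 'a mat set" where
  "clifforder n A = {X \<in> carrier_mat n n. A * X = - (X * A)}"

(* Balancedness is only defined for monic polynomials, so monicity is part of the predicate.
   pcompose f [:0, -1:] is f(-x). *)
definition balanced_poly :: "'a :: comm_ring_1 poly \<Rightarrow> bool" where
  "balanced_poly f \<longleftrightarrow>
     lead_coeff f = 1 \<and> pcompose f [:0, -1:] = smult ((-1) ^ degree f) f"

(* Companion matrix of a monic f of degree d, with ones on the superdiagonal and
   -coeff f 0, ..., -coeff f (d - 1) in the last row. *)
definition companion_mat :: "'a :: comm_ring_1 poly \<Rightarrow> 'a mat" where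
  "companion_mat f = mat (degree f) (degree f)
     (\<lambda>(i, j). if Suc i = degree f then - coeff f j else if j = Suc i then 1 else 0)"

(* fs is the list f_1 | f_2 | ... | f_r of nonconstant monic invariant factors of A, i.e. A is
   similar to its rational canonical form. By the rational canonical form theorem every square
   matrix over a field has exactly one such list. The constant invariant factors 1 that appear in
   the Smith normal form of xI - A are left out. *)
definition invariant_factors :: "'a :: field mat \<Rightarrow> 'a poly list \<Rightarrow> bool" where
  "invariant_factors A fs \<longleftrightarrow>
     (\<forall>f \<in> set fs. lead_coeff f = 1 \<and> 0 < degree f) \<and>
     sorted_wrt (dvd) fs \<and>
     similar_mat A (diag_block_mat (map companion_mat fs))"

(* Since the list of invariant factors exists and is unique, the existential quantifier only
   serves to name it. Constant factors 1 are balanced, so leaving them out does not matter. *)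
definition balanced_mat :: "'a :: field mat \<Rightarrow> bool" where
  "balanced_mat A \<longleftrightarrow> (\<exists>fs. invariant_factors A fs \<and> (\<forall>f \<in> set fs. balanced_poly f))"

definition nilpotent_mat :: "'a :: comm_ring_1 mat \<Rightarrow> bool" where
  "nilpotent_mat A \<longleftrightarrow> (\<exists>k. A ^\<^sub>m k = 0\<^sub>m (dim_row A) (dim_row A))"

(* p(A) = coeff p 0 * I + coeff p 1 * A + ..., written entrywise *)
definition poly_mat :: "'a :: comm_ring_1 poly \<Rightarrow> 'a mat \<Rightarrow> 'a mat" where
  "poly_mat p A = mat (dim_row A) (dim_row A)
     (\<lambda>(i, j). \<Sum>k\<le>degree p. coeff p k * (A ^\<^sub>m k) $$ (i, j))"

definition odd_poly :: "'a :: zero poly \<Rightarrow> bool" where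
  "odd_poly p \<longleftrightarrow> (\<forall>i. even i \<longrightarrow> coeff p i = 0)"

definition odd_polynomial_equivalent :: "'a :: comm_ring_1 mat \<Rightarrow> 'a mat \<Rightarrow> bool" where
  "odd_polynomial_equivalent A B \<longleftrightarrow>
     (\<exists>j k. odd_poly j \<and> odd_poly k \<and> A = poly_mat k B \<and> B = poly_mat j A)"

end

theory Submission
  imports Defs "Jordan_Normal_Form.Jordan_Normal_Form_Existence"
begin

text \<open>
  A balanced matrix \<open>A\<close> anticommutes with some involution \<open>D\<close>: on each companion block of its rational
  canonical form, alternating signs along the basis do it, because a balanced polynomial has
  coefficients only in degrees of one parity
  (\<open>balanced_anticommuting_involution\<close>). Multiplication by \<open>D\<close> then exchanges the clifforder and
  the centralizer of \<open>A\<close>. If the clifforder of \<open>A\<close> is contained in that of \<open>B\<close>, then \<open>D\<close>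
  anticommutes with \<open>B\<close> as well, so the centralizer of \<open>A\<close> is contained in that of \<open>B\<close>.
  A matrix that commutes with the whole centralizer of \<open>A\<close> is a polynomial in \<open>A\<close>
  (\<open>double_centralizer\<close>), hence \<open>B = p(A)\<close>. Conjugation by \<open>D\<close> sends \<open>A\<close> to \<open>- A\<close> and \<open>B\<close> to \<open>- B\<close>,
  so \<open>p(- A) = - p(A)\<close> and \<open>p\<close> can be replaced by its odd part
  (\<open>odd_poly_of_clifforder_subset\<close>). By symmetry, equal clifforders give odd polynomial
  equivalence. The converse is a one-line computation: if \<open>X\<close> anticommutes with \<open>A\<close>, it
  anticommutes with every odd polynomial in \<open>A\<close>.

  The double centralizer property uses the divisibility chain of the invariant factors. The
  largest one annihilates \<open>A\<close>, so the cyclic row vector \<open>e\<close> of its block can be mapped to any row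
  vector by a matrix in the centralizer of \<open>A\<close>. What \<open>B\<close> does to \<open>e\<close> therefore determines
  what it does everywhere, and on \<open>e\<close> it acts as a polynomial in \<open>A\<close>.

  A nilpotent matrix is balanced because its invariant factors are powers of \<open>x\<close>. Over
  a field that need not be algebraically closed, a kernel vector and induction on the size make it
  strictly upper triangular. The Jordan form of a triangular matrix then exists, its only eigenvalue
  is \<open>0\<close>, and a Jordan block for \<open>0\<close> is the companion matrix of a power of \<open>x\<close>. Sorting the
  blocks by size yields the divisibility chain (\<open>nilpotent_mat_balanced\<close>).
\<close>

section \<open>Evaluating polynomials at matrices\<close>

lemma poly_mat_dim [simp]:
  "dim_row (poly_mat p A) = dim_row A" "dim_col (poly_mat p A) = dim_row A"
  by (simp_all add: poly_mat_def)

lemma poly_mat_carrier [simp]: "A \<in> carrier_mat n n \<Longrightarrow> poly_mat p A \<in> carrier_mat n n"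
  by (rule carrier_matI) simp_all

text \<open>
  Any bound above the degree may serve as the upper end of the sum, so that polynomials of
  different degrees can be compared term by term.
\<close>

lemma poly_mat_index:
  assumes "A \<in> carrier_mat n n" "i < n" "j < n" "degree p \<le> N"
  shows "poly_mat p A $$ (i, j) = (\<Sum>k\<le>N. coeff p k * (A ^\<^sub>m k) $$ (i, j))"
proof -
  have "(\<Sum>k\<le>degree p. coeff p k * (A ^\<^sub>m k) $$ (i, j))
      = (\<Sum>k\<le>N. coeff p k * (A ^\<^sub>m k) $$ (i, j))"
    using assms(4) by (intro sum.mono_neutral_left) (auto simp: coeff_eq_0)
  then show ?thesis
    using assms by (simp add: poly_mat_def)
qed

lemma index_mult_mat_sum:
  assumes "A \<in> carrier_mat r n" "B \<in> carrier_mat n c" "i < r" "j < c"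
  shows "(A * B) $$ (i, j) = (\<Sum>l<n. A $$ (i, l) * B $$ (l, j))"
proof -
  have "(A * B) $$ (i, j) = (\<Sum>l = 0..<n. row A i $ l * col B j $ l)"
    using assms by (simp add: scalar_prod_def)
  also have "\<dots> = (\<Sum>l<n. A $$ (i, l) * B $$ (l, j))"
    unfolding atLeast0LessThan by (rule sum.cong) (use assms in auto)
  finally show ?thesis .
qed

lemma mult_poly_mat_index:
  assumes A: "A \<in> carrier_mat n n" and W: "W \<in> carrier_mat r n"
    and "i < r" "j < n" and N: "degree p \<le> N"
  shows "(W * poly_mat p A) $$ (i, j) = (\<Sum>k\<le>N. coeff p k * (W * A ^\<^sub>m k) $$ (i, j))"
proof -
  have "(W * poly_mat p A) $$ (i, j) = (\<Sum>l<n. W $$ (i, l) * poly_mat p A $$ (l, j))"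
    using assms by (intro index_mult_mat_sum) auto
  also have "\<dots> = (\<Sum>l<n. \<Sum>k\<le>N. coeff p k * (W $$ (i, l) * (A ^\<^sub>m k) $$ (l, j)))"
    using assms
    by (intro sum.cong refl) (simp add: poly_mat_index[OF A _ _ N] sum_distrib_left mult.left_commute)
  also have "\<dots> = (\<Sum>k\<le>N. coeff p k * (\<Sum>l<n. W $$ (i, l) * (A ^\<^sub>m k) $$ (l, j)))"
    by (subst sum.swap) (simp only: sum_distrib_left)
  also have "\<dots> = (\<Sum>k\<le>N. coeff p k * (W * A ^\<^sub>m k) $$ (i, j))"
    using assms by (intro sum.cong refl) (simp only: index_mult_mat_sum[OF W pow_carrier_mat[OF A]])
  finally show ?thesis .
qed

lemma poly_mat_0 [simp]: "A \<in> carrier_mat n n \<Longrightarrow> poly_mat 0 A = 0\<^sub>m n n"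
  by (intro eq_matI) (auto simp: poly_mat_def)

text \<open>
  The recursion that lets structural induction on polynomials replace calculations with
  entrywise sums.
\<close>

lemma poly_mat_pCons:
  assumes A: "A \<in> carrier_mat n n"
  shows "poly_mat (pCons a p) A = a \<cdot>\<^sub>m 1\<^sub>m n + poly_mat p A * A"
proof (rule eq_matI)
  fix i j
  assume "i < dim_row (a \<cdot>\<^sub>m 1\<^sub>m n + poly_mat p A * A)"
    and "j < dim_col (a \<cdot>\<^sub>m 1\<^sub>m n + poly_mat p A * A)"
  then have i: "i < n" and j: "j < n"
    using A by auto
  let ?N = "degree p"
  have "poly_mat (pCons a p) A $$ (i, j)
      = (\<Sum>k\<le>Suc ?N. coeff (pCons a p) k * (A ^\<^sub>m k) $$ (i, j))"
    using A i j by (intro poly_mat_index) (auto simp: degree_pCons_le)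
  also have "\<dots> = a * (1\<^sub>m n) $$ (i, j) + (\<Sum>k\<le>?N. coeff p k * (A ^\<^sub>m k * A) $$ (i, j))"
    using A by (subst sum.atMost_Suc_shift) simp
  also have "(\<Sum>k\<le>?N. coeff p k * (A ^\<^sub>m k * A) $$ (i, j))
      = (\<Sum>k\<le>?N. \<Sum>l<n. coeff p k * (A ^\<^sub>m k) $$ (i, l) * A $$ (l, j))"
    by (simp only: index_mult_mat_sum[OF pow_carrier_mat[OF A] A i j] sum_distrib_left mult.assoc)
  also have "\<dots> = (\<Sum>l<n. poly_mat p A $$ (i, l) * A $$ (l, j))"
    by (subst sum.swap, rule sum.cong)
      (auto simp: poly_mat_index[OF A i _ order_refl] sum_distrib_right)
  also have "\<dots> = (poly_mat p A * A) $$ (i, j)"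
    by (rule index_mult_mat_sum[symmetric]) (use A i j in auto)
  finally show "poly_mat (pCons a p) A $$ (i, j) = (a \<cdot>\<^sub>m 1\<^sub>m n + poly_mat p A * A) $$ (i, j)"
    using A i j by simp
qed (use A in auto)

text \<open>
  The instance \<open>A = B\<close> says that \<open>p(A)\<close> commutes with the centralizer of \<open>A\<close>; with \<open>B = - A\<close> it gives
  \<open>X p(A) = p(- A) X\<close> for \<open>X\<close> in the clifforder of \<open>A\<close>; with invertible \<open>X\<close> it is invariance under
  similarity.
\<close>

lemma poly_mat_intertwine:
  assumes A: "A \<in> carrier_mat n n" and B: "B \<in> carrier_mat m m" and X: "X \<in> carrier_mat m n"
    and XA: "X * A = B * X"
  shows "X * poly_mat p A = poly_mat p B * X"
proof (induction p)
  case 0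
  then show ?case using A B X by simp
next
  case (pCons a p)
  let ?P = "poly_mat p A" and ?Q = "poly_mat p B"
  have P: "?P \<in> carrier_mat n n" and Q: "?Q \<in> carrier_mat m m"
    using A B by auto
  have "X * (?P * A) = ?Q * X * A"
    using assoc_mult_mat[OF X P A] pCons.IH by simp
  also have "\<dots> = ?Q * (B * X)"
    using assoc_mult_mat[OF Q X A] XA by simp
  also have "\<dots> = ?Q * B * X"
    using assoc_mult_mat[OF Q B X] by simp
  finally have step: "X * (?P * A) = ?Q * B * X" .
  have "X * poly_mat (pCons a p) A = X * (a \<cdot>\<^sub>m 1\<^sub>m n) + X * (?P * A)"
    unfolding poly_mat_pCons[OF A] by (rule mult_add_distrib_mat[OF X]) (use A P in auto)
  also have "X * (a \<cdot>\<^sub>m 1\<^sub>m n) = (a \<cdot>\<^sub>m 1\<^sub>m m) * X"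
    using X by (simp add: mult_smult_distrib[OF X one_carrier_mat] mult_smult_assoc_mat[OF one_carrier_mat X])
  also have "(a \<cdot>\<^sub>m 1\<^sub>m m) * X + X * (?P * A) = poly_mat (pCons a p) B * X"
    unfolding poly_mat_pCons[OF B] step
    by (rule add_mult_distrib_mat[symmetric]) (use B X Q in auto)
  finally show ?case .
qed

lemma poly_mat_add:
  assumes A: "A \<in> carrier_mat n n"
  shows "poly_mat (p + q) A = poly_mat p A + poly_mat q A"
proof (rule eq_matI)
  fix i j
  assume "i < dim_row (poly_mat p A + poly_mat q A)" "j < dim_col (poly_mat p A + poly_mat q A)"
  then have ij: "i < n" "j < n" using A by auto
  let ?N = "max (degree p) (degree q)"
  show "poly_mat (p + q) A $$ (i, j) = (poly_mat p A + poly_mat q A) $$ (i, j)"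
    using A ij by (simp add: poly_mat_index[OF A ij, of _ ?N] degree_add_le_max sum.distrib distrib_right)
qed (use A in auto)

lemma poly_mat_smult:
  assumes A: "A \<in> carrier_mat n n"
  shows "poly_mat (smult c p) A = c \<cdot>\<^sub>m poly_mat p A"
proof (rule eq_matI)
  fix i j
  assume "i < dim_row (c \<cdot>\<^sub>m poly_mat p A)" "j < dim_col (c \<cdot>\<^sub>m poly_mat p A)"
  then have ij: "i < n" "j < n" using A by auto
  show "poly_mat (smult c p) A $$ (i, j) = (c \<cdot>\<^sub>m poly_mat p A) $$ (i, j)"
    using A ij by (simp add: poly_mat_index[OF A ij, of _ "degree p"] degree_smult_le
        sum_distrib_left mult.assoc)
qed (use A in auto)

lemma poly_mat_mult:
  assumes A: "A \<in> carrier_mat n n"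
  shows "poly_mat (p * q) A = poly_mat p A * poly_mat q A"
proof (induction p)
  case 0
  then show ?case using A by simp
next
  case (pCons a p)
  let ?P = "poly_mat p A" and ?Q = "poly_mat q A"
  have P: "?P \<in> carrier_mat n n" and Q: "?Q \<in> carrier_mat n n"
    using A by auto
  have "?P * ?Q * A = ?P * (A * ?Q)"
    using assoc_mult_mat[OF P Q A] poly_mat_intertwine[OF A A A refl, of q] by simp
  also have "\<dots> = ?P * A * ?Q"
    using assoc_mult_mat[OF P A Q] by simp
  finally have shift: "?P * ?Q * A = ?P * A * ?Q" .
  have "poly_mat (pCons a p * q) A = a \<cdot>\<^sub>m ?Q + (0 \<cdot>\<^sub>m 1\<^sub>m n + ?P * ?Q * A)"
    using A by (simp add: mult_pCons_left poly_mat_add poly_mat_smult poly_mat_pCons pCons.IH)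
  also have "0 \<cdot>\<^sub>m 1\<^sub>m n + ?P * ?Q * A = ?P * A * ?Q"
    using A shift by (intro eq_matI) auto
  also have "a \<cdot>\<^sub>m ?Q + ?P * A * ?Q = (a \<cdot>\<^sub>m 1\<^sub>m n + ?P * A) * ?Q"
    using A P Q by (subst add_mult_distrib_mat[of _ n n _ _ n])
      (auto simp: mult_smult_assoc_mat[OF one_carrier_mat Q])
  finally show ?case
    by (simp add: poly_mat_pCons[OF A])
qed

lemma poly_mat_four_block_diag:
  assumes A: "A \<in> carrier_mat n n" and B: "B \<in> carrier_mat m m"
  shows "poly_mat p (four_block_mat A (0\<^sub>m n m) (0\<^sub>m m n) B)
    = four_block_mat (poly_mat p A) (0\<^sub>m n m) (0\<^sub>m m n) (poly_mat p B)"
    (is "poly_mat p ?M = ?R")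
proof (rule eq_matI)
  fix i j
  assume "i < dim_row ?R" "j < dim_col ?R"
  then have ij: "i < n + m" "j < n + m"
    using A B by auto
  have M: "?M \<in> carrier_mat (n + m) (n + m)"
    using A B by auto
  show "poly_mat p ?M $$ (i, j) = ?R $$ (i, j)"
    using A B ij
    by (auto simp: poly_mat_index[OF M ij order_refl] pow_four_block_mat[OF A B]
        poly_mat_index[OF A _ _ order_refl] poly_mat_index[OF B _ _ order_refl]
        pow_mat_dim_square[OF A] simp del: pow_mat_dim)
qed (use A B in auto)

section \<open>Companion matrices\<close>

lemma companion_mat_dim [simp]:
  "dim_row (companion_mat f) = degree f" "dim_col (companion_mat f) = degree f"
  by (simp_all add: companion_mat_def)

lemma companion_mat_carrier [simp]: "companion_mat f \<in> carrier_mat (degree f) (degree f)"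
  by auto

text \<open>
  With ones on the superdiagonal, the first unit row vector is cyclic: each multiplication by the
  companion matrix from the right moves it one place, up to the last. For this reason row vectors, not column vectors,
  are used in what follows.
\<close>

lemma companion_pow_Suc_row_0:
  assumes k: "k < degree f" and j: "j < degree f"
    and IH: "\<And>l. l < degree f \<Longrightarrow> (companion_mat f ^\<^sub>m k) $$ (0, l) = (if l = k then 1 else 0)"
  shows "(companion_mat f ^\<^sub>m Suc k) $$ (0, j) = companion_mat f $$ (k, j)"
proof -
  let ?C = "companion_mat f" and ?d = "degree f"
  have "(?C ^\<^sub>m Suc k) $$ (0, j) = (\<Sum>l<?d. (?C ^\<^sub>m k) $$ (0, l) * ?C $$ (l, j))"
    using k j by (subst pow_mat.simps, intro index_mult_mat_sum) auto
  also have "\<dots> = (\<Sum>l<?d. if l = k then ?C $$ (l, j) else 0)"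
    using IH by (intro sum.cong) auto
  finally show ?thesis
    using k by simp
qed

lemma companion_pow_row_0:
  "k < degree f \<Longrightarrow> j < degree f \<Longrightarrow>
    (companion_mat f ^\<^sub>m k) $$ (0, j) = (if j = k then 1 else 0)"
proof (induction k arbitrary: j)
  case (Suc k)
  then have "(companion_mat f ^\<^sub>m Suc k) $$ (0, j) = companion_mat f $$ (k, j)"
    by (intro companion_pow_Suc_row_0) auto
  then show ?case
    using Suc.prems by (auto simp: companion_mat_def)
qed auto

text \<open>
  The last row of the companion matrix is chosen so that \<open>f(C)\<close> kills the first unit row vector. That
  vector is cyclic and \<open>f(C)\<close> commutes with \<open>C\<close>, so all rows of \<open>f(C)\<close> vanish.
\<close>

lemma poly_mat_companion:
  assumes monic: "lead_coeff f = 1"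
  shows "poly_mat f (companion_mat f) = 0\<^sub>m (degree f) (degree f)"
proof (rule eq_matI)
  fix i j
  let ?C = "companion_mat f" and ?d = "degree f"
  let ?F = "poly_mat f ?C"
  assume "i < dim_row (0\<^sub>m ?d ?d)" "j < dim_col (0\<^sub>m ?d ?d)"
  then have i: "i < ?d" and j: "j < ?d" by auto
  have C: "?C \<in> carrier_mat ?d ?d" and F: "?F \<in> carrier_mat ?d ?d" by auto
  have top: "?F $$ (0, l) = 0" if l: "l < ?d" for l
  proof -
    obtain e where e: "?d = Suc e"
      using l by (cases ?d) auto
    have "?F $$ (0, l) = (\<Sum>k\<le>Suc e. coeff f k * (?C ^\<^sub>m k) $$ (0, l))"
      using l e by (intro poly_mat_index[OF C]) auto
    also have "\<dots> = (\<Sum>k\<le>e. coeff f k * (?C ^\<^sub>m k) $$ (0, l)) + (?C ^\<^sub>m Suc e) $$ (0, l)"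
      using monic e by (simp del: pow_mat.simps)
    also have "(\<Sum>k\<le>e. coeff f k * (?C ^\<^sub>m k) $$ (0, l)) = (\<Sum>k\<le>e. if k = l then coeff f k else 0)"
      using l e by (intro sum.cong) (auto simp: companion_pow_row_0)
    also have "\<dots> = coeff f l"
      using l e by simp
    also have "(?C ^\<^sub>m Suc e) $$ (0, l) = ?C $$ (e, l)"
      using l e by (intro companion_pow_Suc_row_0) (auto simp: companion_pow_row_0)
    also have "\<dots> = - coeff f l"
      using l e by (simp add: companion_mat_def)
    finally show ?thesis by simp
  qed
  have comm: "?C ^\<^sub>m i * ?F = ?F * ?C ^\<^sub>m i"
  proof (rule poly_mat_intertwine[OF C C])
    show "?C ^\<^sub>m i * ?C = ?C * ?C ^\<^sub>m i"
      using C by (induction i) (auto simp: assoc_mult_mat[of _ ?d ?d _ ?d _ ?d])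
  qed auto
  have "?F $$ (i, j) = (\<Sum>l<?d. if l = i then ?F $$ (l, j) else 0)"
    using i by simp
  also have "\<dots> = (\<Sum>l<?d. (?C ^\<^sub>m i) $$ (0, l) * ?F $$ (l, j))"
    using i by (intro sum.cong) (auto simp: companion_pow_row_0)
  also have "\<dots> = (?C ^\<^sub>m i * ?F) $$ (0, j)"
    by (rule index_mult_mat_sum[symmetric]) (use i j in auto)
  also have "\<dots> = 0"
    unfolding comm using i j
    by (subst index_mult_mat_sum[OF F pow_carrier_mat[OF C]]) (auto simp: top)
  finally show "?F $$ (i, j) = 0\<^sub>m ?d ?d $$ (i, j)"
    using i j by simp
qed auto

lemma poly_mat_diag_companions:
  assumes "\<forall>g \<in> set fs. lead_coeff g = 1 \<and> g dvd f"
  shows "poly_mat f (diag_block_mat (map companion_mat fs))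
    = 0\<^sub>m (sum_list (map degree fs)) (sum_list (map degree fs))"
  using assms
proof (induction fs)
  case Nil
  then show ?case by (simp add: poly_mat_def mat_eq_iff)
next
  case (Cons g fs)
  let ?m = "sum_list (map degree fs)" and ?d = "degree g"
  let ?M = "diag_block_mat (map companion_mat fs)"
  have M: "?M \<in> carrier_mat ?m ?m"
    by (rule carrier_matI) (simp_all add: dim_diag_block_mat comp_def)
  obtain h where "f = g * h"
    using Cons.prems by (auto elim: dvdE)
  then have "poly_mat f (companion_mat g) = 0\<^sub>m ?d ?d"
    using Cons.prems by (simp add: poly_mat_mult[OF companion_mat_carrier] poly_mat_companion
        left_mult_zero_mat[OF poly_mat_carrier[OF companion_mat_carrier]])
  then show ?case
    using Cons M by (simp add: Let_def poly_mat_four_block_diag[OF companion_mat_carrier M])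
qed

section \<open>The double centralizer property\<close>

lemma mat_eq_of_rows:
  fixes A B :: "'a :: semiring_1 mat"
  assumes A: "A \<in> carrier_mat n n" and B: "B \<in> carrier_mat n n"
    and rows: "\<And>W. W \<in> carrier_mat 1 n \<Longrightarrow> W * A = W * B"
  shows "A = B"
proof (rule eq_matI)
  fix i j assume "i < dim_row B" "j < dim_col B"
  then have i: "i < n" and j: "j < n" using B by auto
  let ?W = "mat 1 n (\<lambda>(_, k). if k = i then 1 else 0) :: 'a mat"
  have "(?W * X) $$ (0, j) = X $$ (i, j)" if "X \<in> carrier_mat n n" for X :: "'a mat"
  proof -
    have "(?W * X) $$ (0, j) = (\<Sum>k<n. ?W $$ (0, k) * X $$ (k, j))"
      by (rule index_mult_mat_sum) (use that j in auto)
    also have "\<dots> = (\<Sum>k<n. if k = i then X $$ (k, j) else 0)"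
      by (intro sum.cong) auto
    finally show ?thesis using i by simp
  qed
  from this[OF A] this[OF B] rows[of ?W] show "A $$ (i, j) = B $$ (i, j)" by simp
qed (use A B in auto)

text \<open>
  Since \<open>f\<close> annihilates all of \<open>M\<close> and not only its own block, \<open>x\<^sup>j \<mapsto> w M\<^sup>j\<close> is a well-defined
  homomorphism from that cyclic block to the whole space for every row vector \<open>w\<close>, which supplies enough elements of the centralizer to pin down \<open>B\<close>.
\<close>

lemma double_centralizer_companion_corner:
  fixes M :: "'a :: comm_ring_1 mat"
  assumes N: "N \<in> carrier_mat m m" and monic: "lead_coeff f = 1" and pos: "0 < degree f"
    and M_def: "M = four_block_mat N (0\<^sub>m m (degree f)) (0\<^sub>m (degree f) m) (companion_mat f)"
    and fM: "poly_mat f M = 0\<^sub>m (m + degree f) (m + degree f)"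
    and B: "B \<in> carrier_mat (m + degree f) (m + degree f)"
    and comm: "\<And>X. X \<in> carrier_mat (m + degree f) (m + degree f) \<Longrightarrow> M * X = X * M \<Longrightarrow> B * X = X * B"
  shows "\<exists>q. B = poly_mat q M"
proof -
  define d where "d = degree f"
  define n where "n = m + d"
  let ?C = "companion_mat f"
  have M: "M \<in> carrier_mat n n"
    using N by (auto simp: M_def n_def d_def)
  have B': "B \<in> carrier_mat n n"
    using B by (simp add: n_def d_def)
  have Mpow: "M ^\<^sub>m k \<in> carrier_mat n n" for k
    using M by simp
  \<comment> \<open>\<open>T w\<close> extends this homomorphism by zero on the other blocks, and \<open>e\<close> (here \<open>E\<close>) is the cyclic
      vector of the block for \<open>f\<close>, the unit row vector whose entry \<open>m\<close> is \<open>1\<close>.\<close>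
  define T where "T W = mat n n (\<lambda>(i, k). if i < m then 0 else (W * M ^\<^sub>m (i - m)) $$ (0, k))" for W
  define E :: "'a mat" where "E = mat 1 n (\<lambda>(_, k). if k = m then 1 else 0)"
  have T: "T W \<in> carrier_mat n n" for W
    by (simp add: T_def)
  have E: "E \<in> carrier_mat 1 n"
    by (simp add: E_def)
  have sum_n: "(\<Sum>l<n. h l) = (\<Sum>j<d. h (m + j))" if "\<And>l. l < m \<Longrightarrow> h l = (0 :: 'a)" for h
  proof -
    have "(\<Sum>l<n. h l) = (\<Sum>l<m. h l) + (\<Sum>j<d. h (m + j))"
      unfolding n_def by (induction d) (simp_all add: add.assoc)
    with that show ?thesis by simp
  qed
  have mult_T: "(U * T W) $$ (i, k) = (\<Sum>j<d. U $$ (i, m + j) * (W * M ^\<^sub>m j) $$ (0, k))"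
    if U: "U \<in> carrier_mat r n" and "i < r" "k < n" for U r i k W
  proof -
    have "(U * T W) $$ (i, k) = (\<Sum>l<n. U $$ (i, l) * T W $$ (l, k))"
      using that T[of W] by (intro index_mult_mat_sum) auto
    also have "\<dots> = (\<Sum>j<d. U $$ (i, m + j) * T W $$ (m + j, k))"
      using that by (intro sum_n) (auto simp: T_def n_def)
    also have "\<dots> = (\<Sum>j<d. U $$ (i, m + j) * (W * M ^\<^sub>m j) $$ (0, k))"
      using that by (intro sum.cong) (auto simp: T_def n_def)
    finally show ?thesis .
  qed
  have T_comm: "M * T W = T W * M" if W: "W \<in> carrier_mat 1 n" for W
  proof (rule eq_matI)
    fix i k assume "i < dim_row (T W * M)" "k < dim_col (T W * M)"
    then have i: "i < n" and k: "k < n" using M T[of W] by auto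
    let ?w = "\<lambda>j. (W * M ^\<^sub>m j) $$ (0, k)"
    have TM: "(T W * M) $$ (i, k) = (if i < m then 0 else ?w (Suc (i - m)))"
    proof -
      have "(T W * M) $$ (i, k) = (\<Sum>l<n. T W $$ (i, l) * M $$ (l, k))"
        using i k M T[of W] by (intro index_mult_mat_sum) auto
      also have "\<dots> = (if i < m then 0 else \<Sum>l<n. (W * M ^\<^sub>m (i - m)) $$ (0, l) * M $$ (l, k))"
        using i by (auto simp: T_def)
      also have "(\<Sum>l<n. (W * M ^\<^sub>m (i - m)) $$ (0, l) * M $$ (l, k)) = (W * M ^\<^sub>m (i - m) * M) $$ (0, k)"
        using k M W Mpow[of "i - m"] by (intro index_mult_mat_sum[symmetric]) auto
      also have "W * M ^\<^sub>m (i - m) * M = W * M ^\<^sub>m Suc (i - m)"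
        using assoc_mult_mat[OF W Mpow M] by simp
      finally show ?thesis .
    qed
    have MT: "(M * T W) $$ (i, k) = (\<Sum>j<d. M $$ (i, m + j) * ?w j)"
      by (rule mult_T[OF M i k])
    \<comment> \<open>Inside the block, all rows but the last shift \<open>w M\<^sup>j\<close> to \<open>w M\<^bsup>j+1\<^esup>\<close>; the last row needs \<open>f(M) = 0\<close>.\<close>
    consider "i < m" | i' where "i = m + i'" "Suc i' < d" | i' where "i = m + i'" "Suc i' = d"
      using i unfolding n_def by (metis add_less_cancel_left le_Suc_ex linorder_not_less Suc_lessI)
    then show "(M * T W) $$ (i, k) = (T W * M) $$ (i, k)"
    proof cases
      case 1
      then have "M $$ (i, m + j) = 0" if "j < d" for j
        using that N by (simp add: M_def d_def)
      with 1 show ?thesis unfolding MT TM by simp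
    next
      case 2
      have "M $$ (i, m + j) * ?w j = (if j = Suc i' then ?w j else 0)" if "j < d" for j
        using that 2 N by (simp add: M_def d_def companion_mat_def)
      then have "(\<Sum>j<d. M $$ (i, m + j) * ?w j) = (\<Sum>j<d. if j = Suc i' then ?w j else 0)"
        by simp
      with 2 show ?thesis unfolding MT TM by simp
    next
      case 3
      have "M $$ (i, m + j) * ?w j = - (coeff f j * ?w j)" if "j < d" for j
        using that 3 N by (simp add: M_def d_def companion_mat_def)
      then have MT': "(\<Sum>j<d. M $$ (i, m + j) * ?w j) = - (\<Sum>j<d. coeff f j * ?w j)"
        by (simp add: sum_negf)
      have "(\<Sum>j<d. coeff f j * ?w j) + ?w d = (\<Sum>j\<le>d. coeff f j * ?w j)"
        using monic by (simp add: d_def lessThan_Suc_atMost[symmetric])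
      also have "\<dots> = (W * poly_mat f M) $$ (0, k)"
        using M W k by (intro mult_poly_mat_index[symmetric]) (auto simp: d_def)
      also have "\<dots> = 0"
        using fM W k by (simp add: n_def d_def)
      finally have "- (\<Sum>j<d. coeff f j * ?w j) = ?w d"
        by (rule minus_unique)
      with 3 show ?thesis
        unfolding MT TM MT' by simp
    qed
  qed (use M T[of W] in auto)
  have E_T: "E * T W = W" if W: "W \<in> carrier_mat 1 n" for W
  proof (rule eq_matI)
    fix i k assume "i < dim_row W" "k < dim_col W"
    then have i: "i = 0" and k: "k < n" using W by auto
    have "(E * T W) $$ (0, k) = (\<Sum>j<d. E $$ (0, m + j) * (W * M ^\<^sub>m j) $$ (0, k))"
      by (rule mult_T[OF E _ k]) simp
    also have "\<dots> = (\<Sum>j<d. if j = 0 then (W * M ^\<^sub>m j) $$ (0, k) else 0)"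
      by (intro sum.cong) (auto simp: E_def n_def)
    also have "\<dots> = W $$ (0, k)"
      using pos W M by (simp add: d_def right_mult_one_mat[OF W])
    finally show "(E * T W) $$ (i, k) = W $$ (i, k)" by (simp add: i)
  qed (use E W T[of W] in auto)
  \<comment> \<open>The entries of \<open>e B\<close> on the block are the coefficients of the polynomial sought: \<open>T E\<close> fixes \<open>e\<close>
      and projects onto the block, so \<open>e B = e B T E\<close> is a combination of the vectors \<open>e M\<^sup>j\<close>.\<close>
  define q where "q = (\<Sum>j<d. monom ((E * B) $$ (0, m + j)) j)"
  have coeff_q: "coeff q j = (if j < d then (E * B) $$ (0, m + j) else 0)" for j
    by (simp add: q_def coeff_sum)
  have deg_q: "degree q \<le> d"
    by (rule degree_le) (auto simp: coeff_q)
  have qM: "poly_mat q M \<in> carrier_mat n n"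
    using M by simp
  have EB: "E * B \<in> carrier_mat 1 n"
    using E B' by simp
  have T_B: "T W * B = B * T W" if "W \<in> carrier_mat 1 n" for W
    using comm[of "T W"] T[of W] T_comm[OF that] by (simp add: n_def d_def)
  have EBq: "E * B = E * poly_mat q M"
  proof -
    have "E * B = E * T E * B"
      by (simp add: E_T[OF E])
    also have "\<dots> = E * B * T E"
      using assoc_mult_mat[OF E T B'] assoc_mult_mat[OF E B' T] T_B[OF E] by simp
    also have "\<dots> = E * poly_mat q M"
    proof (rule eq_matI)
      fix i k assume "i < dim_row (E * poly_mat q M)" "k < dim_col (E * poly_mat q M)"
      then have i: "i = 0" and k: "k < n" using E qM by auto
      have "(E * B * T E) $$ (0, k) = (\<Sum>j<d. (E * B) $$ (0, m + j) * (E * M ^\<^sub>m j) $$ (0, k))"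
        by (rule mult_T[OF EB _ k]) simp
      also have "\<dots> = (\<Sum>j\<le>d. coeff q j * (E * M ^\<^sub>m j) $$ (0, k))"
        by (simp add: coeff_q lessThan_Suc_atMost[symmetric])
      also have "\<dots> = (E * poly_mat q M) $$ (0, k)"
        by (rule mult_poly_mat_index[symmetric, OF M E _ k deg_q]) simp
      finally show "(E * B * T E) $$ (i, k) = (E * poly_mat q M) $$ (i, k)" by (simp add: i)
    qed (use E B' qM T[of E] in auto)
    finally show ?thesis .
  qed
  \<comment> \<open>Every row vector is \<open>e T W\<close>, and both \<open>B\<close> and \<open>q(M)\<close> commute with \<open>T W\<close>.\<close>
  have "W * B = W * poly_mat q M" if W: "W \<in> carrier_mat 1 n" for W
  proof -
    have "W * B = E * T W * B"
      by (simp add: E_T[OF W])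
    also have "\<dots> = E * B * T W"
      using assoc_mult_mat[OF E T B'] assoc_mult_mat[OF E B' T] T_B[OF W] by simp
    also have "\<dots> = E * (T W * poly_mat q M)"
      using assoc_mult_mat[OF E qM T] poly_mat_intertwine[OF M M T T_comm[OF W, symmetric]] EBq by simp
    also have "\<dots> = W * poly_mat q M"
      unfolding assoc_mult_mat[OF E T qM, symmetric] E_T[OF W] ..
    finally show ?thesis .
  qed
  then have "B = poly_mat q M"
    by (rule mat_eq_of_rows[OF B' qM])
  then show ?thesis ..
qed

text \<open>
  Being a polynomial in \<open>A\<close> and commuting with the centralizer of \<open>A\<close> are both invariant under
  similarity, so \<open>A\<close> may be taken in rational canonical form. Its last invariant factor is a multiple of
  all the others and so annihilates it.
\<close>

lemma double_centralizer:
  fixes A B :: "'a :: field mat"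
  assumes A: "A \<in> carrier_mat n n" and B: "B \<in> carrier_mat n n"
    and inv: "invariant_factors A fs"
    and comm: "\<And>X. X \<in> carrier_mat n n \<Longrightarrow> A * X = X * A \<Longrightarrow> B * X = X * B"
  shows "\<exists>q. B = poly_mat q A"
proof -
  let ?M = "diag_block_mat (map companion_mat fs)"
  obtain P Q where "similar_mat_wit A ?M P Q"
    using inv by (auto simp: invariant_factors_def similar_mat_def)
  note w = similar_mat_witD2[OF A this]
  note PQ = w(1) and QP = w(2) and AP = w(3) and M = w(5) and P = w(6) and Q = w(7)
  note assoc = assoc_mult_mat[of _ n n _ n _ n]
  have cancel: "P * (Q * X) = X" "Q * (P * X) = X" if "X \<in> carrier_mat n n" for X
    using that P Q PQ QP by (simp_all add: assoc[symmetric])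
  define B' where "B' = Q * B * P"
  have B': "B' \<in> carrier_mat n n" and B_eq: "B = P * B' * Q"
    using B P Q PQ by (auto simp: B'_def assoc cancel)
  have comm': "B' * X = X * B'" if X: "X \<in> carrier_mat n n" and MX: "?M * X = X * ?M" for X
  proof -
    have "A * (P * X * Q) = P * (?M * X) * Q"
      unfolding AP using P Q M X by (simp add: assoc cancel)
    also have "\<dots> = P * X * Q * A"
      unfolding MX AP using P Q M X by (simp add: assoc cancel)
    finally have "B * (P * X * Q) = P * X * Q * B"
      using P Q X by (intro comm) auto
    then have "Q * (B * (P * X * Q)) * P = Q * (P * X * Q * B) * P"
      by simp
    then show ?thesis
      using P Q X B QP by (simp add: B'_def assoc cancel)
  qed
  have "\<exists>q. B' = poly_mat q ?M"
  proof (cases fs rule: rev_cases)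
    case Nil
    then have "n = 0" using M by auto
    then show ?thesis using B' M by (intro exI[of _ 0]) (simp add: mat_eq_iff)
  next
    case (snoc gs f)
    let ?N = "diag_block_mat (map companion_mat gs)" and ?m = "sum_list (map degree gs)"
    have N: "?N \<in> carrier_mat ?m ?m"
      by (rule carrier_matI) (simp_all add: dim_diag_block_mat comp_def)
    have M_eq: "?M = four_block_mat ?N (0\<^sub>m ?m (degree f)) (0\<^sub>m (degree f) ?m) (companion_mat f)"
      using N by (auto simp: snoc diag_block_mat_last Let_def)
    have n: "n = ?m + degree f"
      using M N unfolding M_eq by auto
    have f: "lead_coeff f = 1" "0 < degree f" and dvd: "\<forall>g \<in> set fs. lead_coeff g = 1 \<and> g dvd f"
      using inv by (auto simp: invariant_factors_def snoc sorted_wrt_append)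
    have "poly_mat f ?M = 0\<^sub>m (?m + degree f) (?m + degree f)"
      using poly_mat_diag_companions[OF dvd] by (simp add: snoc)
    from double_centralizer_companion_corner[OF N f M_eq this, of B'] B' comm'
    show ?thesis by (simp add: n)
  qed
  then obtain q where q: "B' = poly_mat q ?M" ..
  have "P * ?M = A * P"
    unfolding AP using P Q M QP by (simp add: assoc)
  from poly_mat_intertwine[OF M A P this, of q] have "B = poly_mat q A * P * Q"
    by (simp add: B_eq q)
  also have "\<dots> = poly_mat q A"
    using P Q A PQ by (simp add: assoc)
  finally show ?thesis ..
qed

section \<open>Parity\<close>

lemma coeff_pcompose_uminus:
  "coeff (pcompose p [:0, -1:]) k = (-1) ^ k * coeff (p :: 'a :: comm_ring_1 poly) k"
proof (induction p arbitrary: k)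
  case (pCons a p)
  then show ?case
    by (cases k) (simp_all add: pcompose_pCons)
qed simp

lemma balanced_poly_coeff:
  assumes "balanced_poly (f :: 'a :: field_char_0 poly)" and "coeff f k \<noteq> 0"
  shows "even k \<longleftrightarrow> even (degree f)"
proof -
  have "coeff (pcompose f [:0, -1:]) k = coeff (smult ((-1) ^ degree f) f) k"
    using assms(1) by (simp add: balanced_poly_def)
  then have "(-1 :: 'a) ^ k = (-1) ^ degree f"
    using assms(2) by (simp add: coeff_pcompose_uminus)
  then show ?thesis
    by (cases "even k"; cases "even (degree f)") auto
qed

lemma pow_mat_uminus:
  assumes A: "(A :: 'a :: comm_ring_1 mat) \<in> carrier_mat n n"
  shows "(- A) ^\<^sub>m k = (-1) ^ k \<cdot>\<^sub>m A ^\<^sub>m k"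
proof (induction k)
  case (Suc k)
  have Ak: "A ^\<^sub>m k \<in> carrier_mat n n"
    using A by simp
  have "(- A) ^\<^sub>m Suc k = ((-1) ^ k \<cdot>\<^sub>m A ^\<^sub>m k) * (- A)"
    by (simp add: Suc.IH)
  also have "\<dots> = (-1) ^ Suc k \<cdot>\<^sub>m (A ^\<^sub>m k * A)"
    using A Ak by (intro eq_matI) (auto simp: mult_smult_assoc_mat[OF Ak])
  finally show ?case by simp
qed (use A in \<open>auto intro!: eq_matI\<close>)

lemma poly_mat_uminus:
  assumes A: "(A :: 'a :: comm_ring_1 mat) \<in> carrier_mat n n"
  shows "poly_mat p (- A) = poly_mat (pcompose p [:0, -1:]) A"
proof (rule eq_matI)
  fix i j
  assume "i < dim_row (poly_mat (pcompose p [:0, -1:]) A)"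
    and "j < dim_col (poly_mat (pcompose p [:0, -1:]) A)"
  then have ij: "i < n" "j < n" using A by auto
  have mA: "- A \<in> carrier_mat n n" using A by simp
  have deg: "degree (pcompose p [:0, -1:]) \<le> degree p"
    by (rule degree_le) (auto simp: coeff_pcompose_uminus coeff_eq_0)
  have Ak: "A ^\<^sub>m k \<in> carrier_mat n n" for k
    using A by simp
  show "poly_mat p (- A) $$ (i, j) = poly_mat (pcompose p [:0, -1:]) A $$ (i, j)"
    unfolding poly_mat_index[OF mA ij order_refl] poly_mat_index[OF A ij deg]
    using ij carrier_matD[OF Ak]
    by (intro sum.cong) (auto simp: pow_mat_uminus[OF A] coeff_pcompose_uminus algebra_simps)
qed (use A in auto)

lemma odd_poly_pcompose_uminus:
  assumes "odd_poly (p :: 'a :: comm_ring_1 poly)"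
  shows "pcompose p [:0, -1:] = smult (-1) p"
proof (rule poly_eqI)
  fix k
  show "coeff (pcompose p [:0, -1:]) k = coeff (smult (-1) p) k"
    using assms by (cases "even k") (simp_all add: coeff_pcompose_uminus odd_poly_def)
qed

lemma poly_mat_odd_uminus:
  assumes "odd_poly p" and A: "(A :: 'a :: comm_ring_1 mat) \<in> carrier_mat n n"
  shows "poly_mat p (- A) = - poly_mat p A"
  unfolding poly_mat_uminus[OF A] odd_poly_pcompose_uminus[OF assms(1)] poly_mat_smult[OF A]
  by (intro eq_matI) auto

section \<open>Clifforders\<close>

lemma clifforder_subset_of_odd_poly:
  assumes A: "A \<in> carrier_mat n n" and "odd_poly j"
  shows "clifforder n A \<subseteq> clifforder n (poly_mat j A)"
proof
  fix X assume "X \<in> clifforder n A"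
  then have X: "X \<in> carrier_mat n n" and AX: "A * X = - (X * A)"
    by (auto simp: clifforder_def)
  have mA: "- A \<in> carrier_mat n n"
    using A by simp
  have "X * (- A) = A * X"
    using A X AX by simp
  from poly_mat_intertwine[OF mA A X this, of j]
  show "X \<in> clifforder n (poly_mat j A)"
    using A X by (simp add: clifforder_def poly_mat_odd_uminus[OF assms(2) A])
qed

text \<open>
  Conjugation carries anticommuting involutions of a canonical form back to the matrix itself.
\<close>

lemma clifforder_similar:
  fixes A :: "'a :: comm_ring_1 mat"
  assumes A: "A \<in> carrier_mat n n" and wit: "similar_mat_wit A M P Q"
    and D: "D \<in> clifforder n M" and DD: "D * D = 1\<^sub>m n"
  shows "P * D * Q \<in> clifforder n A" and "(P * D * Q) * (P * D * Q) = 1\<^sub>m n"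
proof -
  note w = similar_mat_witD2[OF A wit]
  note PQ = w(1) and QP = w(2) and AP = w(3) and M = w(5) and P = w(6) and Q = w(7)
  have D': "D \<in> carrier_mat n n" and MD: "M * D = - (D * M)"
    using D by (auto simp: clifforder_def)
  note assoc = assoc_mult_mat[of _ n n _ n _ n]
  have cancel: "Q * (P * X) = X" if "X \<in> carrier_mat n n" for X
    using that P Q QP by (simp add: assoc[symmetric])
  have "A * (P * D * Q) = P * (M * D) * Q"
    unfolding AP using P Q M D' by (simp add: assoc cancel)
  also have "\<dots> = - (P * (D * M) * Q)"
    unfolding MD using P Q M D' by simp
  also have "P * (D * M) * Q = P * D * Q * A"
    unfolding AP using P Q M D' by (simp add: assoc cancel)
  finally show "P * D * Q \<in> clifforder n A"
    using P D' Q by (simp add: clifforder_def)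
  have "(P * D * Q) * (P * D * Q) = P * (D * D) * Q"
    using P Q D' by (simp add: assoc cancel)
  then show "(P * D * Q) * (P * D * Q) = 1\<^sub>m n"
    using P Q PQ by (simp add: DD)
qed

lemma clifforder_four_block_diag:
  fixes A B :: "'a :: comm_ring_1 mat"
  assumes A: "A \<in> carrier_mat n n" and B: "B \<in> carrier_mat m m"
    and D: "D \<in> clifforder n A" and E: "E \<in> clifforder m B"
  shows "four_block_mat D (0\<^sub>m n m) (0\<^sub>m m n) E
    \<in> clifforder (n + m) (four_block_mat A (0\<^sub>m n m) (0\<^sub>m m n) B)"
proof -
  have D': "D \<in> carrier_mat n n" and AD: "A * D = - (D * A)"
    and E': "E \<in> carrier_mat m m" and BE: "B * E = - (E * B)"
    using D E by (auto simp: clifforder_def)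
  have "four_block_mat A (0\<^sub>m n m) (0\<^sub>m m n) B * four_block_mat D (0\<^sub>m n m) (0\<^sub>m m n) E
      = four_block_mat (A * D) (0\<^sub>m n m) (0\<^sub>m m n) (B * E)"
    using A B D' E' by (subst mult_four_block_mat[OF A _ _ B D' _ _ E']) auto
  also have "\<dots> = - four_block_mat (D * A) (0\<^sub>m n m) (0\<^sub>m m n) (E * B)"
    unfolding AD BE using A B D' E' by (intro eq_matI) auto
  also have "four_block_mat (D * A) (0\<^sub>m n m) (0\<^sub>m m n) (E * B)
      = four_block_mat D (0\<^sub>m n m) (0\<^sub>m m n) E * four_block_mat A (0\<^sub>m n m) (0\<^sub>m m n) B"
    using A B D' E' by (subst mult_four_block_mat[OF D' _ _ E' A _ _ B]) auto
  finally show ?thesis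
    using D' E' by (simp add: clifforder_def)
qed

definition sign_mat :: "nat \<Rightarrow> 'a :: comm_ring_1 mat" where
  "sign_mat d = mat d d (\<lambda>(i, j). if i = j then (-1) ^ i else 0)"

lemma sign_mat_carrier [simp]: "sign_mat d \<in> carrier_mat d d"
  by (simp add: sign_mat_def)

lemma sign_mat_mult:
  assumes X: "X \<in> carrier_mat d d" and i: "i < d" and j: "j < d"
  shows "(sign_mat d * X) $$ (i, j) = (-1) ^ i * X $$ (i, j)"
    and "(X * sign_mat d) $$ (i, j) = (-1) ^ j * X $$ (i, j)"
proof -
  have "(sign_mat d * X) $$ (i, j) = (\<Sum>l<d. sign_mat d $$ (i, l) * X $$ (l, j))"
    by (rule index_mult_mat_sum) (use assms in auto)
  also have "\<dots> = (\<Sum>l<d. if l = i then (-1) ^ i * X $$ (l, j) else 0)"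
    using i by (intro sum.cong) (auto simp: sign_mat_def)
  finally show "(sign_mat d * X) $$ (i, j) = (-1) ^ i * X $$ (i, j)"
    using i by simp
  have "(X * sign_mat d) $$ (i, j) = (\<Sum>l<d. X $$ (i, l) * sign_mat d $$ (l, j))"
    by (rule index_mult_mat_sum) (use assms in auto)
  also have "\<dots> = (\<Sum>l<d. if l = j then (-1) ^ j * X $$ (i, l) else 0)"
    using j by (intro sum.cong) (auto simp: sign_mat_def)
  finally show "(X * sign_mat d) $$ (i, j) = (-1) ^ j * X $$ (i, j)"
    using j by simp
qed

lemma sign_mat_square: "sign_mat d * sign_mat d = 1\<^sub>m d"
proof (rule eq_matI)
  fix i j assume "i < dim_row (1\<^sub>m d)" "j < dim_col (1\<^sub>m d)"
  then show "(sign_mat d * sign_mat d) $$ (i, j) = 1\<^sub>m d $$ (i, j)"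
    by (simp add: sign_mat_mult[OF sign_mat_carrier])
      (simp add: sign_mat_def flip: power_add)
qed (auto simp: sign_mat_def)

text \<open>
  Conjugation by the alternating signs multiplies the entry \<open>(i, j)\<close> by \<open>(-1)\<^bsup>i+j\<^esup>\<close>. This negates the
  superdiagonal, and it negates the last row exactly because every coefficient of \<open>f\<close> whose degree has the
  wrong parity vanishes.
\<close>

lemma sign_mat_in_clifforder_companion:
  assumes f: "balanced_poly (f :: 'a :: field_char_0 poly)"
  shows "sign_mat (degree f) \<in> clifforder (degree f) (companion_mat f)"
proof -
  let ?d = "degree f" and ?C = "companion_mat f"
  have "?C * sign_mat ?d = - (sign_mat ?d * ?C)"
  proof (rule eq_matI)
    fix i j assume "i < dim_row (- (sign_mat ?d * ?C))" "j < dim_col (- (sign_mat ?d * ?C))"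
    then have ij: "i < ?d" "j < ?d" by (auto simp: sign_mat_def)
    have "(-1) ^ j * ?C $$ (i, j) = - ((-1) ^ i * ?C $$ (i, j))"
    proof (cases "Suc i = ?d \<and> coeff f j \<noteq> 0")
      case True
      then have "even j \<longleftrightarrow> even (Suc i)"
        using balanced_poly_coeff[OF f, of j] by simp
      then show ?thesis
        by (cases "even i") auto
    next
      case False
      with ij show ?thesis by (auto simp: companion_mat_def)
    qed
    moreover have "(- (sign_mat ?d * ?C)) $$ (i, j) = - ((sign_mat ?d * ?C) $$ (i, j))"
      using ij by (intro index_uminus_mat) (auto simp: sign_mat_def)
    ultimately show "(?C * sign_mat ?d) $$ (i, j) = (- (sign_mat ?d * ?C)) $$ (i, j)"
      using ij by (simp only: sign_mat_mult[OF companion_mat_carrier])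
  qed (auto simp: sign_mat_def)
  then show ?thesis
    by (simp add: clifforder_def)
qed

lemma balanced_anticommuting_involution:
  fixes A :: "'a :: field_char_0 mat"
  assumes A: "A \<in> carrier_mat n n" and bal: "balanced_mat A"
  obtains D where "D \<in> clifforder n A" "D * D = 1\<^sub>m n"
proof -
  obtain fs where inv: "invariant_factors A fs" and fs: "\<forall>f \<in> set fs. balanced_poly f"
    using bal by (auto simp: balanced_mat_def)
  let ?M = "diag_block_mat (map companion_mat fs)"
  have blocks: "\<exists>D. D \<in> clifforder (sum_list (map degree fs)) ?M \<and> D * D = 1\<^sub>m (sum_list (map degree fs))"
    using fs
  proof (induction fs)
    case Nil
    then show ?case by (intro exI[of _ "1\<^sub>m 0"]) (simp add: clifforder_def mat_eq_iff)
  next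
    case (Cons f fs)
    let ?M = "diag_block_mat (map companion_mat fs)"
      and ?m = "sum_list (map degree fs)" and ?d = "degree f"
    have M: "?M \<in> carrier_mat ?m ?m"
      by (rule carrier_matI) (simp_all add: dim_diag_block_mat comp_def)
    obtain D where D: "D \<in> clifforder ?m ?M" "D * D = 1\<^sub>m ?m"
      using Cons by auto
    then have D': "D \<in> carrier_mat ?m ?m"
      by (simp add: clifforder_def)
    let ?D = "four_block_mat (sign_mat ?d) (0\<^sub>m ?d ?m) (0\<^sub>m ?m ?d) D"
    have "?D * ?D = 1\<^sub>m (?d + ?m)"
      using D' by (subst mult_four_block_mat[OF sign_mat_carrier _ _ D' sign_mat_carrier _ _ D'])
        (auto simp: sign_mat_square D(2) left_mult_zero_mat[OF sign_mat_carrier]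
          right_mult_zero_mat[OF sign_mat_carrier])
    moreover have "?D \<in> clifforder (?d + ?m) (diag_block_mat (map companion_mat (f # fs)))"
      using clifforder_four_block_diag[OF companion_mat_carrier M
          sign_mat_in_clifforder_companion D(1)] Cons.prems M by (simp add: Let_def)
    ultimately show ?case by auto
  qed
  obtain P Q where wit: "similar_mat_wit A ?M P Q"
    using inv by (auto simp: invariant_factors_def similar_mat_def)
  have "?M \<in> carrier_mat n n"
    using similar_mat_witD2[OF A wit] by simp
  then have "sum_list (map degree fs) = n"
    by (auto simp: dim_diag_block_mat comp_def)
  with blocks obtain D where "D \<in> clifforder n ?M" "D * D = 1\<^sub>m n" by auto
  from clifforder_similar[OF A wit this] show thesis by (rule that)
qed

text \<open>
  The involution \<open>D\<close> turns the inclusion of clifforders into an inclusion of centralizers, and it then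
  forces the even part of the resulting polynomial to vanish at \<open>A\<close>.
\<close>

lemma odd_poly_of_clifforder_subset:
  fixes A B :: "'a :: field_char_0 mat"
  assumes A: "A \<in> carrier_mat n n" and B: "B \<in> carrier_mat n n"
    and bal: "balanced_mat A" and sub: "clifforder n A \<subseteq> clifforder n B"
  shows "\<exists>j. odd_poly j \<and> B = poly_mat j A"
proof -
  obtain D where DA: "D \<in> clifforder n A" and DD: "D * D = 1\<^sub>m n"
    using balanced_anticommuting_involution[OF A bal] .
  then have D: "D \<in> carrier_mat n n" and AD: "A * D = - (D * A)" and BD: "B * D = - (D * B)"
    using sub by (auto simp: clifforder_def)
  have D_cancel: "X = Y" if "D * X = D * Y" "X \<in> carrier_mat n n" "Y \<in> carrier_mat n n" for X Y
  proof -
    have "D * D * X = D * D * Y"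
      using that(1) by (simp only: assoc_mult_mat[OF D D that(2)] assoc_mult_mat[OF D D that(3)])
    then show ?thesis
      using that(2,3) by (simp add: DD)
  qed
  have "B * X = X * B" if X: "X \<in> carrier_mat n n" and AX: "A * X = X * A" for X
  proof -
    have "A * (D * X) = - (D * A) * X"
      by (simp only: AD assoc_mult_mat[OF A D X, symmetric])
    also have "\<dots> = - (D * A * X)"
      using A D X by simp
    also have "D * A * X = D * X * A"
      by (simp only: AX assoc_mult_mat[OF D A X] assoc_mult_mat[OF D X A])
    finally have "D * X \<in> clifforder n A"
      using D X by (simp add: clifforder_def)
    with sub have "B * (D * X) = - (D * X * B)"
      by (auto simp: clifforder_def)
    moreover have "B * (D * X) = - (D * B) * X"
      by (simp only: BD assoc_mult_mat[OF B D X, symmetric])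
    moreover have "- (D * B) * X = - (D * (B * X))"
      using B D X by (simp add: assoc_mult_mat[OF D B X])
    ultimately have "- (D * (B * X)) = - (D * (X * B))"
      by (simp only: assoc_mult_mat[OF D X B])
    then have "D * (B * X) = D * (X * B)"
      by (metis uminus_uminus_mat)
    then show ?thesis
      by (rule D_cancel) (use B X in auto)
  qed
  moreover obtain fs where "invariant_factors A fs"
    using bal by (auto simp: balanced_mat_def)
  ultimately obtain p where p: "B = poly_mat p A"
    using double_centralizer[OF A B] by blast
  have mA: "- A \<in> carrier_mat n n"
    using A by simp
  have "D * (- A) = A * D"
    using A D AD by simp
  from poly_mat_intertwine[OF mA A D this, of p] have "D * poly_mat p (- A) = B * D"
    by (simp only: p[symmetric])
  also have "B * D = D * (- B)"
    using B D BD by simp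
  finally have "D * poly_mat p (- A) = D * (- B)" .
  then have even_part: "poly_mat p (- A) = - B"
    by (rule D_cancel) (use A B in auto)
  \<comment> \<open>The odd part \<open>(p(x) - p(- x)) / 2\<close>, whose value at \<open>A\<close> is \<open>(B + B) / 2\<close>.\<close>
  define j where "j = smult (1/2) (p + smult (-1) (pcompose p [:0, -1:]))"
  have "odd_poly j"
    by (auto simp: j_def odd_poly_def coeff_pcompose_uminus)
  moreover have "poly_mat j A = (1/2) \<cdot>\<^sub>m (B + (-1) \<cdot>\<^sub>m (- B))"
    by (simp only: j_def poly_mat_smult[OF A] poly_mat_add[OF A] poly_mat_uminus[OF A, symmetric] even_part p[symmetric])
  then have "B = poly_mat j A"
    using B by (intro eq_matI) auto
  ultimately show ?thesis by blast
qed

lemma clifforder_eq_iff_odd_polynomial_equivalent: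
  fixes A B :: "'a :: field_char_0 mat"
  assumes A: "A \<in> carrier_mat n n" and B: "B \<in> carrier_mat n n"
    and "balanced_mat A" "balanced_mat B"
  shows "clifforder n A = clifforder n B \<longleftrightarrow> odd_polynomial_equivalent A B"
proof
  assume eq: "clifforder n A = clifforder n B"
  then show "odd_polynomial_equivalent A B"
    using odd_poly_of_clifforder_subset[OF A B] odd_poly_of_clifforder_subset[OF B A] assms
    unfolding odd_polynomial_equivalent_def by blast
next
  assume "odd_polynomial_equivalent A B"
  then obtain j k where "odd_poly j" "odd_poly k" "A = poly_mat k B" "B = poly_mat j A"
    by (auto simp: odd_polynomial_equivalent_def)
  then show "clifforder n A = clifforder n B"
    using clifforder_subset_of_odd_poly[OF A, of j] clifforder_subset_of_odd_poly[OF B, of k] by auto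
qed

section \<open>Nilpotent matrices are similar to strictly upper triangular ones\<close>

text \<open>
  Replacing the first column of a permutation matrix by \<open>v\<close> multiplies the determinant by an entry of \<open>v\<close>
  (Cramer's rule). The permutation, exchanging \<open>0\<close> and some index \<open>i\<close>, is chosen so that this entry is nonzero.
\<close>

lemma nonzero_vec_first_col_invertible:
  fixes v :: "'a :: field vec"
  assumes v: "v \<in> carrier_vec n" and nz: "v \<noteq> 0\<^sub>v n"
  obtains P Q where "P \<in> carrier_mat n n" "Q \<in> carrier_mat n n"
    "P * Q = 1\<^sub>m n" "Q * P = 1\<^sub>m n" "col P 0 = v"
proof -
  obtain i where i: "i < n" and vi: "v $ i \<noteq> 0"
    using v nz by (auto simp: vec_eq_iff)
  let ?S = "swaprows_mat n 0 i :: 'a mat"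
  have S: "?S \<in> carrier_mat n n" and SS: "?S * ?S = 1\<^sub>m n"
    using i by (auto intro: swaprows_mat_inv)
  let ?P = "replace_col ?S v 0"
  have P: "?P \<in> carrier_mat n n"
    by (simp add: replace_col_def)
  have "?S *\<^sub>v (?S *\<^sub>v v) = v"
    using v by (simp add: assoc_mult_mat_vec[OF S S v, symmetric] SS)
  then have "det ?P = (?S *\<^sub>v v) $ 0 * det ?S"
    using cramer_lemma_mat[OF S, of "?S *\<^sub>v v" 0] i S v by simp
  also have "(?S *\<^sub>v v) $ 0 = (\<Sum>j<n. ?S $$ (0, j) * v $ j)"
    using i v by (auto simp: scalar_prod_def atLeast0LessThan intro!: sum.cong)
  also have "\<dots> = (\<Sum>j<n. if j = i then v $ j else 0)"
    using i by (intro sum.cong) auto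
  also have "\<dots> = v $ i"
    using i by simp
  finally have "det ?P = v $ i * det ?S" .
  moreover have "det ?S \<noteq> 0"
    using det_mult[OF S S] SS by auto
  ultimately have "det ?P \<noteq> 0"
    using vi by simp
  from det_non_zero_imp_unit[OF P this, of "()"]
  obtain Q where "Q \<in> carrier_mat n n" "Q * ?P = 1\<^sub>m n" "?P * Q = 1\<^sub>m n"
    by (auto simp: Units_def ring_mat_def)
  moreover have "col ?P 0 = v"
    using i v by (intro eq_vecI) (auto simp: replace_col_def)
  ultimately show thesis
    using P that by blast
qed

lemma pow_four_block_upper_triangular:
  fixes A D :: "'a :: semiring_1 mat"
  assumes A: "A \<in> carrier_mat n n" and B: "B \<in> carrier_mat n m" and D: "D \<in> carrier_mat m m"
  shows "\<exists>Y \<in> carrier_mat n m.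
    four_block_mat A B (0\<^sub>m m n) D ^\<^sub>m k = four_block_mat (A ^\<^sub>m k) Y (0\<^sub>m m n) (D ^\<^sub>m k)"
proof (induction k)
  case 0
  show ?case
    using A D by (intro bexI[of _ "0\<^sub>m n m"]) auto
next
  case (Suc k)
  then obtain Y where Y: "Y \<in> carrier_mat n m" and
    IH: "four_block_mat A B (0\<^sub>m m n) D ^\<^sub>m k = four_block_mat (A ^\<^sub>m k) Y (0\<^sub>m m n) (D ^\<^sub>m k)"
    by blast
  have Ak: "A ^\<^sub>m k \<in> carrier_mat n n" and Dk: "D ^\<^sub>m k \<in> carrier_mat m m"
    using A D by auto
  have Y': "A ^\<^sub>m k * B + Y * D \<in> carrier_mat n m"
    using Ak B Y D by simp
  have "four_block_mat A B (0\<^sub>m m n) D ^\<^sub>m Suc k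
      = four_block_mat (A ^\<^sub>m Suc k) (A ^\<^sub>m k * B + Y * D) (0\<^sub>m m n) (D ^\<^sub>m Suc k)"
    unfolding pow_mat.simps IH
    by (subst mult_four_block_mat[OF Ak Y _ Dk A B _ D]) (use A B D Y Ak Dk in auto)
  with Y' show ?case by blast
qed

text \<open>
  A nilpotent matrix is singular. In a basis that starts with a kernel vector its first column is zero,
  and the remaining diagonal block is nilpotent of smaller size.
\<close>

lemma nilpotent_similar_strictly_upper_triangular:
  fixes A :: "'a :: field mat"
  assumes "A \<in> carrier_mat n n" and "A ^\<^sub>m k = 0\<^sub>m n n"
  shows "\<exists>U \<in> carrier_mat n n. similar_mat A U \<and> (\<forall>i<n. \<forall>j\<le>i. U $$ (i, j) = 0)"
  using assms
proof (induction n arbitrary: A)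
  case 0
  then show ?case using similar_mat_refl by blast
next
  case (Suc n)
  let ?n = "Suc n"
  have A: "A \<in> carrier_mat ?n ?n" by fact
  have det_pow: "det (A ^\<^sub>m l) = det A ^ l" for l
    using A by (induction l) (simp_all add: det_mult[OF pow_carrier_mat[OF A] A])
  have "det A = 0"
    using det_pow[of k] by (simp add: Suc.prems)
  then obtain v where v: "v \<in> carrier_vec ?n" "v \<noteq> 0\<^sub>v ?n" "A *\<^sub>v v = 0\<^sub>v ?n"
    using det_0_iff_vec_prod_zero_field[OF A] by blast
  obtain P Q where P: "P \<in> carrier_mat ?n ?n" and Q: "Q \<in> carrier_mat ?n ?n"
    and PQ: "P * Q = 1\<^sub>m ?n" and QP: "Q * P = 1\<^sub>m ?n" and colP: "col P 0 = v"
    using nonzero_vec_first_col_invertible[OF v(1,2)] .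
  define C where "C = Q * A * P"
  have C: "C \<in> carrier_mat ?n ?n"
    using A P Q by (simp add: C_def)
  have wit: "similar_mat_wit C A Q P"
    by (rule similar_mat_witI[OF QP PQ C_def C A Q P])
  have col0: "C $$ (i, 0) = 0" if "i < ?n" for i
  proof -
    have "col C 0 = Q * A *\<^sub>v v"
      unfolding C_def colP[symmetric] by (rule col_mult2) (use A P Q in auto)
    also have "\<dots> = 0\<^sub>v ?n"
      using assoc_mult_mat_vec[OF Q A v(1)] v(3) Q by (simp, intro eq_vecI) auto
    finally have "col C 0 $ i = 0\<^sub>v ?n $ i" by simp
    then show ?thesis using that C by simp
  qed
  define R where "R = mat 1 n (\<lambda>(i, j). C $$ (i, Suc j))"
  define D where "D = mat n n (\<lambda>(i, j). C $$ (Suc i, Suc j))"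
  have R: "R \<in> carrier_mat 1 n" and D: "D \<in> carrier_mat n n"
    by (simp_all add: R_def D_def)
  have C_eq: "C = four_block_mat (0\<^sub>m 1 1) R (0\<^sub>m n 1) D"
    by (rule eq_matI) (use C in \<open>auto simp: R_def D_def col0 less_Suc_eq_0_disj\<close>)
  obtain Z Y where Z: "Z \<in> carrier_mat 1 1"
    and Ck: "C ^\<^sub>m k = four_block_mat Z Y (0\<^sub>m n 1) (D ^\<^sub>m k)"
    using pow_four_block_upper_triangular[OF zero_carrier_mat R D] pow_carrier_mat[OF zero_carrier_mat]
    unfolding C_eq by blast
  have "C ^\<^sub>m k = 0\<^sub>m ?n ?n"
    using similar_mat_wit_pow_id[OF wit, of k] Suc.prems(2) P Q by simp
  then have zero: "four_block_mat Z Y (0\<^sub>m n 1) (D ^\<^sub>m k) = 0\<^sub>m ?n ?n"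
    using Ck by simp
  have "(D ^\<^sub>m k) $$ (i, j) = 0" if "i < n" "j < n" for i j
    using arg_cong[OF zero, of "\<lambda>X. X $$ (Suc i, Suc j)"] that Z pow_mat_dim_square[OF D, of k]
    by (simp del: pow_mat_dim)
  then have "D ^\<^sub>m k = 0\<^sub>m n n"
    by (intro eq_matI) (use D pow_mat_dim_square[OF D] in auto)
  from Suc.IH[OF D this] obtain U where U: "U \<in> carrier_mat n n"
    and DU: "similar_mat D U" and upper: "\<forall>i<n. \<forall>j\<le>i. U $$ (i, j) = 0"
    by blast
  obtain R' where R': "R' \<in> carrier_mat 1 n"
    and CU: "similar_mat C (four_block_mat (0\<^sub>m 1 1) R' (0\<^sub>m n 1) U)"
    using similar_mat_four_block_0_ex[OF similar_mat_refl[OF zero_carrier_mat] DU R zero_carrier_mat D]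
    unfolding C_eq by blast
  let ?U = "four_block_mat (0\<^sub>m 1 1) R' (0\<^sub>m n 1) U"
  have "similar_mat A C"
    using similar_mat_wit_sym[OF wit] by (auto simp: similar_mat_def)
  then have "similar_mat A ?U"
    using CU by (rule similar_mat_trans)
  moreover have "?U \<in> carrier_mat ?n ?n"
    using four_block_carrier_mat[OF zero_carrier_mat[of 1 1] U] by simp
  moreover have "\<forall>i<?n. \<forall>j\<le>i. ?U $$ (i, j) = 0"
  proof (intro allI impI)
    fix i j assume "i < ?n" "j \<le> i"
    then have "i < ?n" "j < ?n" "j \<le> i" by auto
    then show "?U $$ (i, j) = 0"
      using U upper by (cases i; cases j) auto
  qed
  ultimately show ?case by blast
qed

section \<open>Reordering diagonal blocks\<close>

lemma similar_mat_four_block_diag_swap: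
  fixes A B :: "'a :: semiring_1 mat"
  assumes A: "A \<in> carrier_mat n n" and B: "B \<in> carrier_mat m m"
  shows "similar_mat (four_block_mat A (0\<^sub>m n m) (0\<^sub>m m n) B)
    (four_block_mat B (0\<^sub>m m n) (0\<^sub>m n m) A)" (is "similar_mat ?L ?R")
proof -
  let ?P = "four_block_mat (0\<^sub>m n m) (1\<^sub>m n) (1\<^sub>m m) (0\<^sub>m m n) :: 'a mat"
  let ?Q = "four_block_mat (0\<^sub>m m n) (1\<^sub>m m) (1\<^sub>m n) (0\<^sub>m n m) :: 'a mat"
  note z = zero_carrier_mat and o = one_carrier_mat
  have PQ: "?P * ?Q = 1\<^sub>m (n + m)"
    by (subst mult_four_block_mat[OF z o o z z o o z]) auto
  have QP: "?Q * ?P = 1\<^sub>m (n + m)"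
    by (subst mult_four_block_mat[OF z o o z z o o z]) (auto simp: add.commute)
  have "?P * ?R = four_block_mat (0\<^sub>m n m) A B (0\<^sub>m m n)"
    using A B by (subst mult_four_block_mat[OF z o o z B z z A]) auto
  moreover have "four_block_mat (0\<^sub>m n m) A B (0\<^sub>m m n) * ?Q = ?L"
    using A B by (subst mult_four_block_mat[OF z A B z z o o z]) auto
  ultimately have "?L = ?P * ?R * ?Q" by simp
  moreover have "{?L, ?R, ?P, ?Q} \<subseteq> carrier_mat (n + m) (n + m)"
    using A B by (auto simp: add.commute intro!: carrier_matI)
  ultimately show ?thesis
    using PQ QP by (intro similar_matI) auto
qed

text \<open>
  The Jordan normal form lists its blocks in no particular order, whereas invariant factors have to form
  a divisibility chain.
\<close>

lemma similar_mat_diag_block_mat_perm: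
  fixes As Bs :: "'a :: semiring_1 mat list"
  assumes "mset As = mset Bs" and "\<forall>A \<in> set As. square_mat A"
  shows "similar_mat (diag_block_mat As) (diag_block_mat Bs)"
  using assms
proof (induction As arbitrary: Bs)
  case Nil
  then show ?case by (auto intro: similar_mat_refl[of _ 0])
next
  case (Cons A As)
  then obtain Bs1 Bs2 where Bs: "Bs = Bs1 @ A # Bs2"
    by (metis list.set_intros(1) set_mset_mset split_list)
  with Cons.prems have mset: "mset As = mset (Bs1 @ Bs2)" by simp
  have carr: "diag_block_mat Xs \<in> carrier_mat (dim_row (diag_block_mat Xs)) (dim_row (diag_block_mat Xs))"
    if "\<forall>X \<in> set Xs. square_mat X" for Xs :: "'a mat list"
    using diag_block_mat_square[of Xs] that by (intro carrier_matI) auto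
  have "set Bs \<subseteq> set (A # As)"
    using Cons.prems(1) by (metis mset_eq_setD order_refl)
  then have sq: "\<forall>X \<in> set Bs1. square_mat X" "\<forall>X \<in> set Bs2. square_mat X"
      "\<forall>X \<in> set As. square_mat X" "square_mat A"
    using Cons.prems(2) Bs by auto
  define a where "a = dim_row A"
  define b where "b = dim_row (diag_block_mat Bs1)"
  define c where "c = dim_row (diag_block_mat Bs2)"
  define d where "d = dim_row (diag_block_mat As)"
  have A: "A \<in> carrier_mat a a"
    using sq(4) by (intro carrier_matI) (auto simp: a_def)
  have B1: "diag_block_mat Bs1 \<in> carrier_mat b b" and B2: "diag_block_mat Bs2 \<in> carrier_mat c c"
    and D: "diag_block_mat As \<in> carrier_mat d d"
    using carr sq by (auto simp: b_def c_def d_def)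
  have step1: "similar_mat (diag_block_mat (A # As)) (diag_block_mat (A # Bs1 @ Bs2))"
  proof -
    have IH: "similar_mat (diag_block_mat As) (diag_block_mat (Bs1 @ Bs2))"
      using Cons.IH[OF mset] sq by blast
    then have "diag_block_mat (Bs1 @ Bs2) \<in> carrier_mat d d"
      using D by (auto dest!: similar_matD)
    with similar_mat_four_block_0_0[OF similar_mat_refl[OF A] IH A D] A D
    show ?thesis by (simp add: Let_def)
  qed
  have swap: "similar_mat (four_block_mat A (0\<^sub>m a b) (0\<^sub>m b a) (diag_block_mat Bs1))
      (four_block_mat (diag_block_mat Bs1) (0\<^sub>m b a) (0\<^sub>m a b) A)"
    by (rule similar_mat_four_block_diag_swap[OF A B1])
  have AB1: "four_block_mat A (0\<^sub>m a b) (0\<^sub>m b a) (diag_block_mat Bs1) \<in> carrier_mat (a + b) (a + b)"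
    using A B1 by auto
  have "diag_block_mat ((A # Bs1) @ Bs2) = four_block_mat
      (four_block_mat A (0\<^sub>m a b) (0\<^sub>m b a) (diag_block_mat Bs1)) (0\<^sub>m (a + b) c) (0\<^sub>m c (a + b)) (diag_block_mat Bs2)"
    unfolding diag_block_mat_append using A B1 B2 by (simp add: Let_def)
  moreover have "diag_block_mat ((Bs1 @ [A]) @ Bs2) = four_block_mat
      (four_block_mat (diag_block_mat Bs1) (0\<^sub>m b a) (0\<^sub>m a b) A) (0\<^sub>m (a + b) c) (0\<^sub>m c (a + b)) (diag_block_mat Bs2)"
    unfolding diag_block_mat_append diag_block_mat_singleton using A B1 B2 by (simp add: Let_def add.commute)
  ultimately have "similar_mat (diag_block_mat (A # Bs1 @ Bs2)) (diag_block_mat Bs)"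
    using similar_mat_four_block_0_0[OF swap similar_mat_refl[OF B2] AB1 B2] by (simp add: Bs)
  with step1 show ?case by (rule similar_mat_trans)
qed

section \<open>Nilpotent matrices are balanced\<close>

lemma companion_mat_monom:
  "companion_mat (monom 1 d) = (jordan_block d 0 :: 'a :: comm_ring_1 mat)"
  by (rule eq_matI) (auto simp: companion_mat_def degree_monom_eq)

lemma balanced_poly_monom: "balanced_poly (monom 1 d :: 'a :: comm_ring_1 poly)"
proof -
  have "pcompose (monom (1 :: 'a) d) [:0, -1:] = smult ((-1) ^ d) (monom 1 d)"
    by (simp add: monom_altdef pcompose_hom.hom_power pcompose_pCons flip: smult_power)
  then show ?thesis
    by (simp add: balanced_poly_def degree_monom_eq)
qed

text \<open>
  All eigenvalues are zero because the characteristic polynomial, read off from the triangular form, is a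
  power of \<open>x\<close>. Powers of \<open>x\<close> are ordered by divisibility as their exponents are by size, so sorting the
  Jordan blocks produces the list of invariant factors.
\<close>

lemma nilpotent_mat_balanced:
  fixes A :: "'a :: field mat"
  assumes A: "A \<in> carrier_mat n n" and "nilpotent_mat A"
  shows "balanced_mat A"
proof -
  obtain k where "A ^\<^sub>m k = 0\<^sub>m n n"
    using assms by (auto simp: nilpotent_mat_def)
  from nilpotent_similar_strictly_upper_triangular[OF A this]
  obtain U where U: "U \<in> carrier_mat n n" and AU: "similar_mat A U"
    and upper: "\<forall>i<n. \<forall>j\<le>i. U $$ (i, j) = 0" by blast
  have ut: "upper_triangular U"
    using U upper by auto
  obtain n_as where jnf: "jordan_nf U n_as"
    using triangular_to_jnf_vector[OF U ut] by blast
  have "diag_mat U = replicate n 0"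
    using U upper by (intro nth_equalityI) (auto simp: diag_mat_def)
  then have char: "(\<Prod>(m, a)\<leftarrow>n_as. [:- a, 1:] ^ m) = [:0, 1:] ^ n"
    using char_poly_upper_triangular[OF U ut] jordan_nf_char_poly[OF jnf] by (simp add: prod_list_replicate)
  have pos: "0 < m" if "(m, a) \<in> set n_as" for m a
    using jnf that by (force simp: jordan_nf_def)
  have zero: "a = 0" if "(m, a) \<in> set n_as" for m a
  proof -
    have "[:- a, 1:] dvd [:- a, 1:] ^ m"
      using pos[OF that] by (simp add: dvd_power)
    also have "\<dots> dvd (\<Prod>(m, a)\<leftarrow>n_as. [:- a, 1:] ^ m)"
      using that by (intro prod_list_dvd) (force simp: image_iff)
    finally have "poly ([:0, 1:] ^ n) a = 0"
      unfolding char by (simp only: poly_eq_0_iff_dvd)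
    then show ?thesis by simp
  qed
  let ?ns = "map fst n_as"
  let ?fs = "map (monom (1 :: 'a)) (sort ?ns)"
  have "jordan_matrix n_as = diag_block_mat (map (\<lambda>m. jordan_block m (0 :: 'a)) ?ns)"
    unfolding jordan_matrix_def by (rule arg_cong[of _ _ diag_block_mat]) (auto dest: zero)
  then have "similar_mat A (diag_block_mat (map (\<lambda>m. jordan_block m (0 :: 'a)) ?ns))"
    using similar_mat_trans[OF AU] jnf by (simp add: jordan_nf_def)
  moreover have "similar_mat (diag_block_mat (map (\<lambda>m. jordan_block m (0 :: 'a)) ?ns))
      (diag_block_mat (map companion_mat ?fs))"
    by (rule similar_mat_diag_block_mat_perm) (auto simp: companion_mat_monom comp_def image_mset.compositionality)
  ultimately have "similar_mat A (diag_block_mat (map companion_mat ?fs))"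
    by (rule similar_mat_trans)
  moreover have "sorted_wrt (dvd) ?fs"
  proof -
    have "sorted_wrt (\<le>) (sort ?ns)"
      by simp
    then have "sorted_wrt (\<lambda>x y. monom (1 :: 'a) x dvd monom 1 y) (sort ?ns)"
      by (rule sorted_wrt_mono_rel[rotated]) (simp add: monom_altdef le_imp_power_dvd)
    then show ?thesis
      by (simp add: sorted_wrt_map)
  qed
  moreover have "\<forall>f \<in> set ?fs. lead_coeff f = 1 \<and> 0 < degree f"
    using pos by (auto simp: degree_monom_eq)
  ultimately show ?thesis
    unfolding balanced_mat_def invariant_factors_def
    by (intro exI[of _ ?fs]) (auto simp: balanced_poly_monom)
qed

section \<open>Clifforders of balanced matrices\<close>

theorem theorem5p3:
  fixes A B :: "'a :: field_char_0 mat" and n :: nat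
  assumes "A \<in> carrier_mat n n" and "B \<in> carrier_mat n n"
    and "balanced_mat A" and "balanced_mat B"
  shows "(clifforder n A = clifforder n B \<longleftrightarrow> odd_polynomial_equivalent A B) \<and>
    (\<forall>N :: 'a mat. N \<in> carrier_mat n n \<longrightarrow> nilpotent_mat N \<longrightarrow> balanced_mat N)"
  using clifforder_eq_iff_odd_polynomial_equivalent[OF assms] nilpotent_mat_balanced by blast

end
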